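(* Let $n\in\mathbb{N}$. The number $N_n$ of distinct $n\times n$ principal reversible squares is \[N_n=\sum_{j=1}^{\Omega(n)}c_j(n)\big(c_j(n)+c_{j+1}(n)\big)=\sum_{j=1}^{\Omega(n)}c_j^{(0)}(n)\,c_j^{(1)}(n).\]
   Context: For $j,n\in\mathbb{N}$, $c_j(n)$ is the number of ordered $j$-tuples of integers each $\ge 2$ with product $n$; $c_j^{(0)}=c_j$ and $c_j^{(1)}(n)=\sum_{m\mid n}c_j(m)$. If $n=p_1^{a_1}\cdots p_t^{a_t}$ is the prime factorisation, $\Omega(n)=a_1+\dots+a_t$. A reversible square matrix is a real matrix $M=(M_{i,j})$ with indices $i,j\in\mathbb{Z}_n=\mathbb{Z}/n\mathbb{Z}$ (the top-left entry having index $(1,1)$, with indices computed modulo $n$) such that (R) $M_{i,j}+M_{i,n+1-j}=M_{i,k}+M_{i,n+1-k}$ and $M_{i,j}+M_{n+1-i,j}=M_{k,j}+M_{n+1-k,j}$ for all $i,j,k\in\mathbb{Z}_n$, and (V) $M_{i,j}+M_{k,l}=M_{i,l}+M_{k,j}$ for all $i,j,k,l\in\mathbb{Z}_n$. An $n\times n$ principal reversible square is a reversible square matrix whose set of entries is exactly $\{1,2,\dots,n^2\}$, whose entries increase along each row (left to right) and each column (top to bottom), and which satisfies $M_{1,1}=1$, $M_{1,2}=2$. *)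

theory Defs
  imports Complex_Main "HOL-Computational_Algebra.Primes"
begin

definition c :: "nat \<Rightarrow> nat \<Rightarrow> nat" where
  "c j n = card {xs :: int list. length xs = j \<and> (\<forall>x\<in>set xs. x \<ge> 2) \<and> prod_list xs = int n}"

definition c1 :: "nat \<Rightarrow> nat \<Rightarrow> nat" where
  "c1 j n = (\<Sum>m\<in>{m. m dvd n}. c j m)"

definition Omega :: "nat \<Rightarrow> nat" where
  "Omega n = size (prime_factorization n)"

text \<open>An n x n real matrix is stored as M :: nat => nat => real on 0..n-1 (zero outside).
  The entry with (integer) label (i,j), labels taken modulo n with top-left label (1,1),
  is ent n M i j.\<close>
definition ent :: "nat \<Rightarrow> (nat \<Rightarrow> nat \<Rightarrow> real) \<Rightarrow> int \<Rightarrow> int \<Rightarrow> real" where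
  "ent n M i j = M (nat ((i - 1) mod int n)) (nat ((j - 1) mod int n))"

definition reversible_square :: "nat \<Rightarrow> (nat \<Rightarrow> nat \<Rightarrow> real) \<Rightarrow> bool" where
  "reversible_square n M \<longleftrightarrow>
     (\<forall>i j k::int. ent n M i j + ent n M i (int n + 1 - j) = ent n M i k + ent n M i (int n + 1 - k)
                 \<and> ent n M i j + ent n M (int n + 1 - i) j = ent n M k j + ent n M (int n + 1 - k) j)
   \<and> (\<forall>i j k l::int. ent n M i j + ent n M k l = ent n M i l + ent n M k j)"

definition principal_reversible_square :: "nat \<Rightarrow> (nat \<Rightarrow> nat \<Rightarrow> real) \<Rightarrow> bool" where
  "principal_reversible_square n M \<longleftrightarrow>
     reversible_square n M
   \<and> {ent n M i j | i j. i \<in> {1..int n} \<and> j \<in> {1..int n}} = (\<lambda>k. real k) ` {1..n^2}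
   \<and> (\<forall>i\<in>{1..int n}. \<forall>j\<in>{1..int n}. \<forall>j'\<in>{1..int n}. j < j' \<longrightarrow> ent n M i j < ent n M i j')
   \<and> (\<forall>j\<in>{1..int n}. \<forall>i\<in>{1..int n}. \<forall>i'\<in>{1..int n}. i < i' \<longrightarrow> ent n M i j < ent n M i' j)
   \<and> ent n M 1 1 = 1 \<and> ent n M 1 2 = 2"

text \<open>Number of distinct n x n principal reversible squares (matrices with entries
  only at positions 0..n-1, zero elsewhere, so that distinct matrices are distinct functions).\<close>
definition N :: "nat \<Rightarrow> nat" where
  "N n = card {M. principal_reversible_square n M \<and> (\<forall>i j. (i \<ge> n \<or> j \<ge> n) \<longrightarrow> M i j = 0)}"

end

theory Submission
  imports Defs
begin

text \<open>By (V), a principal reversible square has the form \<open>M i j = 1 + a j + b i\<close> with increasing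
  sequences \<open>a\<close>, \<open>b\<close> of natural numbers starting at \<open>0\<close>. Their value sets \<open>A\<close>, \<open>B\<close> have \<open>n\<close> elements,
  every number below \<open>n\<^sup>2\<close> is uniquely a sum \<open>x + y\<close> with \<open>x \<in> A\<close>, \<open>y \<in> B\<close>, and \<open>1 \<in> A\<close>. More
  generally let \<open>F(a, b)\<close> count such tilings of \<open>[0, a b)\<close> with \<open>card A = a\<close> and \<open>card B = b\<close>. If
  \<open>b \<ge> 2\<close> and \<open>k\<close> is the least positive element of \<open>B\<close>, then \<open>A = [0, k) + k A'\<close> and \<open>B = k B'\<close>
  (de Bruijn), where \<open>B'\<close>, \<open>A'\<close> is again a tiling and \<open>1 \<in> B'\<close>. Hence \<open>F(a, b)\<close> is the sum of
  \<open>F(b, a / k)\<close> over the divisors \<open>k \<ge> 2\<close> of \<open>a\<close>, and the recursion for \<open>c\<close> over the first factor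
  gives \<open>F(a, b) = (\<Sum>j. c j b * (c j a + c (j + 1) a))\<close> by induction. The same decomposition
  shows that \<open>A\<close> and \<open>B\<close> are symmetric, which is (R).\<close>

subsection \<open>Ordered factorisations\<close>

definition ofacs :: "nat \<Rightarrow> nat \<Rightarrow> int list set" where
  "ofacs j n = {xs. length xs = j \<and> (\<forall>x\<in>set xs. x \<ge> 2) \<and> prod_list xs = int n}"

definition pdivs :: "nat \<Rightarrow> nat set" where
  "pdivs n = {k. k dvd n \<and> 2 \<le> k}"

lemma c_eq_card_ofacs: "c j n = card (ofacs j n)"
  by (simp add: c_def ofacs_def)

lemma finite_pdivs [simp]: "n \<ge> 1 \<Longrightarrow> finite (pdivs n)"
  unfolding pdivs_def by (rule finite_subset[of _ "{k. k dvd n}"]) auto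

lemma ofacs_0: "ofacs 0 n = (if n = 1 then {[]} else {})"
  by (auto simp: ofacs_def)

text \<open>Split off the first factor \<open>k\<close>; the remaining list is a factorisation of
  the cofactor. The pieces are disjoint because the head determines \<open>k\<close>, which gives
  the recursion \<open>c_Suc\<close>.\<close>

lemma ofacs_Suc:
  assumes "n \<ge> 1"
  shows "ofacs (Suc j) n = (\<Union>k\<in>pdivs n. (#) (int k) ` ofacs j (n div k))"
proof (intro equalityI subsetI)
  fix xs assume "xs \<in> ofacs (Suc j) n"
  then obtain y ys where xs: "xs = y # ys" and "length ys = j" "\<forall>x\<in>set ys. x \<ge> 2" "y \<ge> 2"
    and prod: "y * prod_list ys = int n"
    by (auto simp: ofacs_def length_Suc_conv)
  obtain k where k: "y = int k" "k \<ge> 2"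
    using \<open>y \<ge> 2\<close> by (metis nat_0_le nat_le_eq_zle int_nat_eq nat_numeral order_trans zero_le_numeral)
  have "k dvd n" using prod k by (metis dvd_triv_left int_dvd_int_iff)
  then obtain m where m: "n = k * m" by blast
  with prod k have "prod_list ys = int m" by simp
  with m k have "ys \<in> ofacs j (n div k)"
    using \<open>length ys = j\<close> \<open>\<forall>x\<in>set ys. x \<ge> 2\<close> by (simp add: ofacs_def)
  with \<open>k dvd n\<close> k xs show "xs \<in> (\<Union>k\<in>pdivs n. (#) (int k) ` ofacs j (n div k))"
    by (auto simp: pdivs_def)
next
  fix xs assume "xs \<in> (\<Union>k\<in>pdivs n. (#) (int k) ` ofacs j (n div k))"
  then show "xs \<in> ofacs (Suc j) n"
    by (auto simp: ofacs_def pdivs_def simp flip: of_nat_mult)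
qed

lemma div_pdivs_ge_1: "n \<ge> 1 \<Longrightarrow> k \<in> pdivs n \<Longrightarrow> n div k \<ge> 1"
  by (auto simp: pdivs_def dvd_def)

lemma finite_ofacs: "n \<ge> 1 \<Longrightarrow> finite (ofacs j n)"
proof (induction j arbitrary: n)
  case (Suc j)
  then show ?case
    using div_pdivs_ge_1[OF Suc.prems] by (simp add: ofacs_Suc)
qed (simp add: ofacs_0)

lemma c_0: "c 0 n = (if n = 1 then 1 else 0)"
  by (simp add: c_eq_card_ofacs ofacs_0)

lemma c_Suc:
  assumes "n \<ge> 1"
  shows "c (Suc j) n = (\<Sum>k\<in>pdivs n. c j (n div k))"
proof -
  have "card (ofacs (Suc j) n) = (\<Sum>k\<in>pdivs n. card ((#) (int k) ` ofacs j (n div k)))"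
    unfolding ofacs_Suc[OF assms] using assms
    by (intro card_UN_disjoint) (auto intro!: finite_imageI finite_ofacs div_pdivs_ge_1)
  then show ?thesis
    by (simp add: c_eq_card_ofacs card_image)
qed

lemma c_Suc_1: "c (Suc j) 1 = 0"
proof -
  have "pdivs 1 = {}" by (auto simp: pdivs_def)
  then show ?thesis by (simp add: c_Suc)
qed

lemma Omega_div_less:
  assumes "n \<ge> 1" "k \<in> pdivs n"
  shows "Omega (n div k) < Omega n"
proof -
  obtain m where m: "n = k * m" and k: "k \<ge> 2" using assms by (auto simp: pdivs_def)
  with assms have "m \<noteq> 0" by auto
  have "prime_factorization k \<noteq> {#}"
    using k by (simp add: prime_factorization_empty_iff)
  then show ?thesis
    using m k \<open>m \<noteq> 0\<close> by (simp add: Omega_def prime_factorization_mult nonempty_has_size)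
qed

text \<open>Each factor is at least 2 and so uses up at least one prime of \<open>n\<close>. This
  makes sums over \<open>j\<close> insensitive to their upper bound.\<close>

lemma c_eq_0: "n \<ge> 1 \<Longrightarrow> Omega n < j \<Longrightarrow> c j n = 0"
proof (induction j arbitrary: n)
  case (Suc j)
  have "c j (n div k) = 0" if "k \<in> pdivs n" for k
    using Omega_div_less[OF Suc.prems(1) that] Suc.prems div_pdivs_ge_1[OF Suc.prems(1) that]
    by (intro Suc.IH) auto
  then show ?case by (simp add: c_Suc[OF Suc.prems(1)])
qed simp

text \<open>The divisor \<open>n\<close> contributes \<open>c j n\<close>. The proper divisors
  \<open>m\<close> correspond to the possible first factors \<open>n div m\<close> of a
  factorisation with one more factor.\<close>

lemma c1_eq:
  assumes "n \<ge> 1"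
  shows "c1 j n = c j n + c (Suc j) n"
proof -
  have "(\<Sum>m\<in>{m. m dvd n} - {n}. c j m) = (\<Sum>k\<in>pdivs n. c j (n div k))"
  proof (rule sum.reindex_bij_witness[where i = "\<lambda>k. n div k" and j = "\<lambda>k. n div k"])
    fix m assume "m \<in> {m. m dvd n} - {n}"
    then obtain d where d: "n = m * d" "m \<noteq> n" by auto
    with assms have "m \<noteq> 0" "d \<noteq> 0" "d \<noteq> 1" by auto
    with d show "n div (n div m) = m" "n div m \<in> pdivs n" "c j (n div (n div m)) = c j m"
      by (auto simp: pdivs_def)
  next
    fix k assume "k \<in> pdivs n"
    then obtain d where d: "n = k * d" "k \<ge> 2" by (auto simp: pdivs_def)
    with assms have "k \<noteq> 0" "d \<noteq> 0" by auto
    with d show "n div (n div k) = k" "n div k \<in> {m. m dvd n} - {n}" by auto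
  qed
  moreover have "(\<Sum>m\<in>{m. m dvd n}. c j m) = c j n + (\<Sum>m\<in>{m. m dvd n} - {n}. c j m)"
    using assms by (intro sum.remove) auto
  ultimately show ?thesis using assms by (simp add: c1_def c_Suc)
qed

subsection \<open>Tilings of an interval by two sets\<close>

text \<open>The direct sum decomposition A \<oplus> B = [0, L): bijectivity packs together existence
  and uniqueness of the representation \<open>x + y\<close>.\<close>

definition tiles :: "nat set \<Rightarrow> nat set \<Rightarrow> nat \<Rightarrow> bool" where
  "tiles A B L \<longleftrightarrow> bij_betw (\<lambda>(x, y). x + y) (A \<times> B) {..<L}"

lemma tiles_unique:
  assumes "tiles A B L" "x \<in> A" "y \<in> B" "x' \<in> A" "y' \<in> B" "x + y = x' + y'"
  shows "x = x'" "y = y'"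
  using assms by (auto simp: tiles_def bij_betw_def inj_on_def)

lemma tiles_less: "tiles A B L \<Longrightarrow> x \<in> A \<Longrightarrow> y \<in> B \<Longrightarrow> x + y < L"
  by (auto simp: tiles_def bij_betw_def)

lemma tiles_obtain:
  assumes "tiles A B L" "z < L"
  obtains x y where "x \<in> A" "y \<in> B" "z = x + y"
proof -
  have "z \<in> (\<lambda>(x, y). x + y) ` (A \<times> B)" using assms by (simp add: tiles_def bij_betw_def)
  with that show thesis by auto
qed

lemma tilesI:
  assumes "\<And>x y x' y'. x \<in> A \<Longrightarrow> y \<in> B \<Longrightarrow> x' \<in> A \<Longrightarrow> y' \<in> B \<Longrightarrow> x + y = x' + y' \<Longrightarrow> x = x' \<and> y = y'"
    and "\<And>x y. x \<in> A \<Longrightarrow> y \<in> B \<Longrightarrow> x + y < L"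
    and "\<And>z. z < L \<Longrightarrow> \<exists>x\<in>A. \<exists>y\<in>B. z = x + y"
  shows "tiles A B L"
  unfolding tiles_def bij_betw_def
proof
  show "inj_on (\<lambda>(x, y). x + y) (A \<times> B)" using assms(1) by (auto simp: inj_on_def)
  show "(\<lambda>(x, y). x + y) ` (A \<times> B) = {..<L}" using assms(2,3) by force
qed

lemma tiles_0_mem:
  assumes "tiles A B L" "L > 0"
  shows "0 \<in> A" "0 \<in> B"
proof -
  obtain x y where "x \<in> A" "y \<in> B" "0 = x + y" using tiles_obtain[OF assms] .
  then show "0 \<in> A" "0 \<in> B" by auto
qed

lemma tiles_commute:
  assumes "tiles A B L"
  shows "tiles B A L"
proof (rule tilesI)
  fix x y x' y' assume *: "x \<in> B" "y \<in> A" "x' \<in> B" "y' \<in> A" "x + y = x' + y'"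
  then have "y + x = y' + x'" by simp
  with * show "x = x' \<and> y = y'" using tiles_unique[OF assms] by blast
next
  fix x y assume "x \<in> B" "y \<in> A"
  then show "x + y < L" using tiles_less[OF assms, of y x] by simp
next
  fix z assume "z < L"
  then obtain x y where "x \<in> A" "y \<in> B" "z = x + y" using tiles_obtain[OF assms] by blast
  then show "\<exists>x\<in>B. \<exists>y\<in>A. z = x + y" using add.commute by blast
qed

lemma mem_block:
  fixes k x :: nat
  assumes "k > 0"
  shows "x \<in> {x div k * k..<x div k * k + k}"
  using div_mult_mod_eq[of x k] mod_less_divisor[OF assms, of x] unfolding atLeastLessThan_iff
  by linarith

text \<open>Here \<open>k\<close> is the least positive element of \<open>B\<close>. The induction shows that \<open>A\<close> is a union of
  blocks \<open>[m k, (m + 1) k)\<close> and that \<open>B\<close> consists of multiples of \<open>k\<close>; in each step the question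
  is how the left endpoint \<open>m k\<close> is represented as \<open>a + b\<close>.\<close>

lemma tiles_blocks:
  assumes T: "tiles A B L" and L: "L > 0"
    and k: "k \<in> B" "k > 0" and min: "\<And>y. y \<in> B \<Longrightarrow> 0 < y \<Longrightarrow> k \<le> y"
  shows "(m * k \<in> A \<longrightarrow> {m * k..<m * k + k} \<subseteq> A) \<and> (m * k \<notin> A \<longrightarrow> {m * k..<m * k + k} \<inter> A = {})
       \<and> B \<inter> {m * k..<m * k + k} \<subseteq> {m * k}"
proof (induction m rule: less_induct)
  case (less m)
  note zero = tiles_0_mem[OF T L]
  have kN: "k < L" using tiles_less[OF T zero(1) k(1)] by simp
  \<comment> \<open>A representation of \<open>x < k\<close> uses an element of \<open>B\<close>
    below \<open>k\<close>, which is 0 by minimality.\<close>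
  have small: "x \<in> A" if xk: "x < k" for x
  proof -
    obtain a b where "a \<in> A" "b \<in> B" "x = a + b"
      using tiles_obtain[OF T order_less_trans[OF xk kN]] by blast
    with min[of b] xk show ?thesis by (cases "b = 0") auto
  qed
  have IHA: "x \<in> A \<longleftrightarrow> (x div k) * k \<in> A" if "x < m * k" for x
  proof -
    have "x div k < m" using that by (simp add: less_mult_imp_div_less)
    moreover have "x \<in> {x div k * k..<x div k * k + k}"
      by (rule mem_block[OF k(2)])
    ultimately show ?thesis using less.IH[of "x div k"] by blast
  qed
  have IHB: "k dvd x" if "x < m * k" "x \<in> B" for x
  proof -
    have "x div k < m" using that by (simp add: less_mult_imp_div_less)
    moreover have "x \<in> {x div k * k..<x div k * k + k}"
      by (rule mem_block[OF k(2)])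
    ultimately have "x = x div k * k" using less.IH[of "x div k"] that by blast
    then show ?thesis by (metis dvd_triv_right)
  qed
  show ?case
  proof (cases "m = 0")
    case True
    have "y = 0" if "y \<in> B" "y < k" for y using min[of y] that by force
    then show ?thesis using True zero small by auto
  next
    case False
    then have mk: "k \<le> m * k" by simp
    show ?thesis
    proof (cases "m * k < L")
      case True
      then obtain a b where ab: "a \<in> A" "b \<in> B" "m * k = a + b"
        using tiles_obtain[OF T] by blast
      consider "b = 0" | "b > 0" by blast
      then show ?thesis
      proof cases
        case 2
        \<comment> \<open>By induction \<open>b\<close>, and hence \<open>a\<close>, is a multiple
          of \<open>k\<close> (unless \<open>a = 0\<close>), so \<open>A\<close> contains the whole
          block starting at \<open>a\<close>. Its translate by \<open>b\<close> covers the block at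
          \<open>m * k\<close>, so no point there has another representation.\<close>
        have full: "a + r \<in> A" if rk: "r < k" for r
        proof (cases "a = 0")
          case True
          then show ?thesis using small[OF rk] by simp
        next
          case False
          then have "a < m * k" "b < m * k" using ab 2 by auto
          from IHB[OF this(2) ab(2)] ab(3) have "k dvd a"
            by (metis dvd_add_left_iff dvd_triv_right)
          then obtain q where q: "a = q * k" by (metis dvd_div_mult_self)
          then have "q < m" using \<open>a < m * k\<close> by simp
          then have "{q * k..<q * k + k} \<subseteq> A" using less.IH[of q] ab q by blast
          moreover have "a + r \<in> {q * k..<q * k + k}" using rk by (simp add: q)
          ultimately show ?thesis by blast
        qed
        have nA: "x \<notin> A" if xm: "x \<in> {m * k..<m * k + k}" for x
        proof
          assume "x \<in> A"
          have "a + (x - m * k) \<in> A" by (rule full) (use xm in auto)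
          moreover have "x + 0 = a + (x - m * k) + b" using xm ab(3) by simp
          ultimately show False using tiles_unique(2)[OF T \<open>x \<in> A\<close> zero(2) _ ab(2)] 2 by blast
        qed
        have nB: "x = m * k" if xm: "x \<in> {m * k..<m * k + k}" and xB: "x \<in> B" for x
        proof -
          have "a + (x - m * k) \<in> A" by (rule full) (use xm in auto)
          moreover have "0 + x = a + (x - m * k) + b" using xm ab(3) by simp
          ultimately have "0 = a + (x - m * k)" using tiles_unique(1)[OF T zero(1) xB _ ab(2)] by blast
          then show ?thesis using xm by simp
        qed
        have "m * k \<notin> A" using k(2) by (intro nA) simp
        then show ?thesis using nA nB by blast
      next
        case 1
        with ab have mkA: "m * k \<in> A" by simp
        \<comment> \<open>The right end of the block is itself a sum from \<open>A\<close> and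
          \<open>B\<close>, so every point of the block lies below \<open>L\<close> and has a
          representation.\<close>
        have lt: "m * k + k < L" using tiles_less[OF T mkA k(1)] .
        have all: "x \<in> A" if x: "x \<in> {m * k..<m * k + k}" for x
        proof -
          obtain a' b' where ab': "a' \<in> A" "b' \<in> B" "x = a' + b'"
            using tiles_obtain[OF T, of x] x lt by (metis atLeastLessThan_iff order_less_trans)
          have "b' = 0"
          proof (rule ccontr)
            \<comment> \<open>A positive \<open>b'\<close> yields two representations of
              \<open>m * k\<close> if \<open>b' \<le> m * k\<close>, and of \<open>m * k + k\<close>
              otherwise.\<close>
            assume "b' \<noteq> 0"
            show False
            proof (cases "b' < m * k")
              case True
              from IHB[OF this ab'(2)] obtain q where q: "b' = q * k" by (metis dvd_div_mult_self)
              with True \<open>b' \<noteq> 0\<close> have "q < m" "q > 0" by auto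
              \<comment> \<open>The point \<open>a'\<close> lies in the block starting at
                \<open>(m - q) * k\<close>, so by induction that endpoint is in \<open>A\<close>;
                then \<open>(m - q) * k + b'\<close> competes with \<open>m * k + 0\<close>.\<close>
              then have mq: "m * k = (m - q) * k + b'" using q by (simp add: diff_mult_distrib)
              have "a' \<in> {(m - q) * k..<(m - q) * k + k}" using x ab'(3) mq by auto
              with less.IH[of "m - q"] \<open>q < m\<close> \<open>q > 0\<close> ab'(1) have "(m - q) * k \<in> A" by fastforce
              then show False
                using tiles_unique(2)[OF T mkA zero(2) _ ab'(2), of "(m - q) * k"] mq \<open>b' \<noteq> 0\<close> by simp
            next
              case False
              show False
              proof (cases "b' = m * k")
                case True
                then show False
                  using tiles_unique(2)[OF T mkA zero(2) zero(1) ab'(2)] \<open>b' \<noteq> 0\<close> by simp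
              next
                case neq: False
                \<comment> \<open>The gap \<open>d\<close> is below \<open>k\<close>, hence in
                  \<open>A\<close>, so \<open>d + b'\<close> competes with \<open>m * k\<close> plus
                  \<open>k\<close>.\<close>
                define d where "d = m * k + k - b'"
                have "b' < m * k + k" using x ab'(3) by auto
                then have d: "d < k" "d + b' = m * k + k" using False neq by (auto simp: d_def)
                then have "d = m * k" using tiles_unique(1)[OF T small[OF d(1)] ab'(2) mkA k(1)] by simp
                then show False using d(1) mk by simp
              qed
            qed
          qed
          then show ?thesis using ab' by simp
        qed
        \<comment> \<open>A positive element common to \<open>A\<close> and \<open>B\<close> would
          give \<open>x + 0 = 0 + x\<close>.\<close>
        have nB: "x \<notin> B" if "x \<in> {m * k..<m * k + k}" for x
        proof
          assume "x \<in> B"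
          then have "x = 0" using tiles_unique(1)[OF T all[OF that] zero(2) zero(1) \<open>x \<in> B\<close>] by simp
          then show False using that mk k(2) by simp
        qed
        show ?thesis using all nB mkA by blast
      qed
    next
      case False
      have "x \<notin> A \<and> x \<notin> B" if "x \<ge> m * k" for x
        using tiles_less[OF T, of x 0] tiles_less[OF T, of 0 x] zero that False by auto
      then show ?thesis using k(2) by auto
    qed
  qed
qed

section \<open>Scaling a tiling by a factor\<close>

definition inflate :: "nat \<Rightarrow> nat set \<Rightarrow> nat set" where
  "inflate k A = {x. x div k \<in> A}"

text \<open>Division with remainder exhibits the set as [0, k) + k A, the form in which its elements
  can be counted.\<close>

lemma inflate_eq_image:
  assumes "k > 0"
  shows "inflate k A = (\<lambda>(r, x). x * k + r) ` ({..<k} \<times> A)"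
proof (intro equalityI subsetI)
  fix x assume "x \<in> inflate k A"
  then have "(x mod k, x div k) \<in> {..<k} \<times> A" using assms by (simp add: inflate_def)
  moreover have "x = (\<lambda>(r, x). x * k + r) (x mod k, x div k)" by simp
  ultimately show "x \<in> (\<lambda>(r, x). x * k + r) ` ({..<k} \<times> A)" by blast
qed (auto simp: inflate_def)

lemma card_inflate:
  assumes "k > 0"
  shows "card (inflate k A) = k * card A"
proof -
  have "inj_on (\<lambda>(r, x). x * k + r) ({..<k} \<times> A)"
  proof (rule inj_onI, clarsimp)
    fix r x r' x' assume *: "r < k" "r' < k" and eq: "x * k + r = x' * k + r'"
    have "(x * k + r) div k = x" "(x' * k + r') div k = x'" using * by auto
    with eq show "r = r' \<and> x = x'" by auto
  qed
  then show ?thesis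
    by (simp add: inflate_eq_image[OF assms] card_image card_cartesian_product)
qed

text \<open>Dividing \<open>x + k * z\<close> by \<open>k\<close> gives \<open>x div k + z\<close>,
  a representation in the original tiling; the remainder is carried by \<open>x\<close>
  alone.\<close>

lemma tiles_inflate:
  assumes k: "k > 0" and T: "tiles A B L"
  shows "tiles (inflate k A) ((*) k ` B) (k * L)"
proof (rule tilesI)
  fix x y x' y'
  assume *: "x \<in> inflate k A" "y \<in> (*) k ` B" "x' \<in> inflate k A" "y' \<in> (*) k ` B" "x + y = x' + y'"
  then obtain z z' where z: "z \<in> B" "y = k * z" "z' \<in> B" "y' = k * z'" by blast
  have "(x + y) div k = x div k + z" "(x' + y') div k = x' div k + z'"
    using k z by simp_all
  with * z tiles_unique(2)[OF T] have "z = z'" unfolding inflate_def by (metis mem_Collect_eq)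
  then show "x = x' \<and> y = y'" using * z by simp
next
  fix x y assume "x \<in> inflate k A" "y \<in> (*) k ` B"
  then obtain z where z: "z \<in> B" "y = k * z" "x div k \<in> A" by (auto simp: inflate_def)
  then have "(x + y) div k < L" using k tiles_less[OF T z(3,1)] by (simp add: add.commute)
  then show "x + y < k * L" using k by (simp add: div_less_iff_less_mult mult.commute)
next
  fix w assume "w < k * L"
  then have "w div k < L" using k by (simp add: div_less_iff_less_mult mult.commute)
  then obtain x y where xy: "x \<in> A" "y \<in> B" "w div k = x + y" using tiles_obtain[OF T] by blast
  have "w = (k * x + w mod k) + k * y"
    using xy(3) by (metis add.assoc add.commute distrib_left mult_div_mod_eq)
  moreover have "k * x + w mod k \<in> inflate k A" using xy k by (simp add: inflate_def)
  ultimately show "\<exists>x\<in>inflate k A. \<exists>y\<in>(*) k ` B. w = x + y" using xy by blast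
qed

text \<open>Restrict to multiples of \<open>k\<close>: \<open>x\<close> in \<open>A\<close> is
  represented by \<open>k * x\<close> in \<open>inflate k A\<close>, and the factor \<open>k\<close>
  cancels.\<close>

lemma tiles_deflate:
  assumes k: "k > 0" and T: "tiles (inflate k A) ((*) k ` B) (k * L)"
  shows "tiles A B L"
proof (rule tilesI)
  have mem: "k * x \<in> inflate k A" if "x \<in> A" for x using that k by (simp add: inflate_def)
  {
    fix x y x' y'
    assume "x \<in> A" "y \<in> B" "x' \<in> A" "y' \<in> B" "x + y = x' + y'"
    then show "x = x' \<and> y = y'"
      using tiles_unique[OF T mem[of x] _ mem[of x'], of "k * y" "k * y'"] k
      by (simp flip: distrib_left)
  next
    fix x y assume "x \<in> A" "y \<in> B"
    then show "x + y < L"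
      using tiles_less[OF T mem[of x], of "k * y"] k by (simp flip: distrib_left)
  next
    fix w assume "w < L"
    then have "k * w < k * L" using k by simp
    then obtain x y where xy: "x \<in> inflate k A" "y \<in> B" "k * w = x + k * y"
      using tiles_obtain[OF T] by blast
    have "w = (k * w) div k" using k by simp
    also have "\<dots> = x div k + y" using k by (simp add: xy(3))
    finally show "\<exists>x\<in>A. \<exists>y\<in>B. w = x + y" using xy by (auto simp: inflate_def)
  }
qed

text \<open>Once \<open>a * b > 1\<close>, the number 1 lies in exactly one of the two factors, so
  \<open>1 \<in> A\<close> fixes their order. For squares it encodes the normalisation that the
  second entry of the first row is 2.\<close>

definition tilings :: "nat \<Rightarrow> nat \<Rightarrow> (nat set \<times> nat set) set" where
  "tilings a b = {(A, B). card A = a \<and> card B = b \<and> 1 \<in> A \<and> tiles A B (a * b)}"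

text \<open>The argument lists the factor to be scaled first, because that is the one containing 1
  in the smaller tiling.\<close>

definition inflate_pair :: "nat \<Rightarrow> nat set \<times> nat set \<Rightarrow> nat set \<times> nat set" where
  "inflate_pair k = (\<lambda>(B, A). (inflate k A, (*) k ` B))"

text \<open>The divisor \<open>k\<close> is recovered from a tiling as the least positive element of \<open>B\<close>. After dividing
  out \<open>k\<close>, that element becomes \<open>1\<close>, so the two factors exchange their roles.\<close>

lemma tilings_step:
  assumes a: "a \<ge> 1" and b: "b \<ge> 2"
  shows "tilings a b = (\<Union>k\<in>pdivs a. inflate_pair k ` tilings b (a div k))"
proof (intro equalityI subsetI)
  fix p assume "p \<in> tilings a b"
  then obtain A B where p: "p = (A, B)" and card: "card A = a" "card B = b" and one: "1 \<in> A"
    and T: "tiles A B (a * b)" by (auto simp: tilings_def)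
  have L: "a * b > 0" using a b by simp
  note zero = tiles_0_mem[OF T L]
  \<comment> \<open>At least two elements in \<open>B\<close> guarantee a positive one, so the least
    positive element exists.\<close>
  have "\<not> B \<subseteq> {0}" using card b by (metis card_mono card.empty card_insert_disjoint empty_iff
      finite.emptyI finite.insertI not_less_eq_eq numeral_2_eq_2 order_trans)
  then have ex: "\<exists>y. y \<in> B \<and> 0 < y" by auto
  define k where "k = (LEAST y. y \<in> B \<and> 0 < y)"
  have k: "k \<in> B" "k > 0" using LeastI_ex[OF ex] by (auto simp: k_def)
  have min: "k \<le> y" if "y \<in> B" "0 < y" for y using that by (auto simp: k_def intro: Least_le)
  \<comment> \<open>Otherwise 1 would be both \<open>1 + 0\<close> and \<open>0 + 1\<close>.\<close>
  have "k \<noteq> 1" using tiles_unique(1)[OF T one zero(2) zero(1), of 1] k by auto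
  with k have k2: "k \<ge> 2" by simp
  define A' B' where "A' = {x. x * k \<in> A}" and "B' = {x. x * k \<in> B}"
  note blocks = tiles_blocks[OF T L k min]
  have in_block: "x \<in> {x div k * k..<x div k * k + k}" for x
    by (rule mem_block[OF k(2)])
  have A: "A = inflate k A'"
    using blocks in_block unfolding inflate_def A'_def by blast
  have B: "B = (*) k ` B'"
  proof (intro equalityI subsetI)
    fix x assume "x \<in> B"
    with blocks[of "x div k"] in_block[of x] have x: "x = x div k * k" by blast
    with \<open>x \<in> B\<close> have "x div k \<in> B'" by (simp add: B'_def)
    with x show "x \<in> (*) k ` B'" by (metis image_eqI mult.commute)
  qed (auto simp: B'_def mult.commute)
  \<comment> \<open>Counting \<open>A\<close> block by block shows that \<open>k\<close> divides
    \<open>a\<close>.\<close>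
  have cA: "a = k * card A'" using card_inflate[OF k(2), of A'] A card by simp
  have cB: "card B' = b"
    using card B k by (metis card_image inj_on_def mult_left_cancel less_irrefl)
  have "tiles A' B' (card A' * b)"
  proof (rule tiles_deflate[OF k(2)])
    have "a * b = k * (card A' * b)" using cA by simp
    then show "tiles (inflate k A') ((*) k ` B') (k * (card A' * b))"
      using T by (simp only: A[symmetric] B[symmetric])
  qed
  then have "tiles B' A' (b * card A')" using tiles_commute by (simp add: mult.commute)
  moreover have "1 \<in> B'" using k by (simp add: B'_def)
  ultimately have "(B', A') \<in> tilings b (a div k)" using cA cB k by (simp add: tilings_def)
  moreover have "p = inflate_pair k (B', A')" using p A B by (simp add: inflate_pair_def)
  moreover have "k \<in> pdivs a" using cA k2 by (auto simp: pdivs_def)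
  ultimately show "p \<in> (\<Union>k\<in>pdivs a. inflate_pair k ` tilings b (a div k))" by blast
next
  fix p assume "p \<in> (\<Union>k\<in>pdivs a. inflate_pair k ` tilings b (a div k))"
  then obtain k A B where k: "k dvd a" "k \<ge> 2" and AB: "(B, A) \<in> tilings b (a div k)"
    and p: "p = (inflate k A, (*) k ` B)" by (auto simp: pdivs_def inflate_pair_def)
  then have T: "tiles A B (a div k * b)" and card: "card B = b" "card A = a div k"
    using tiles_commute[of B A] by (auto simp: tilings_def mult.commute)
  have "a div k * b > 0" using k a b by (auto simp: dvd_def)
  then have "0 \<in> A" using tiles_0_mem[OF T] by blast
  \<comment> \<open>Since \<open>k \<ge> 2\<close>, the number 1 lies in the block of 0.\<close>
  then have "1 \<in> inflate k A" using k by (simp add: inflate_def)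
  moreover have "tiles (inflate k A) ((*) k ` B) (a * b)"
    using tiles_inflate[OF _ T, of k] k by (simp flip: mult.assoc)
  moreover have "card (inflate k A) = a" using card_inflate[of k A] k card by simp
  moreover have "card ((*) k ` B) = b"
    using card k by (subst card_image) (auto simp: inj_on_def)
  ultimately show "p \<in> tilings a b" using p by (simp add: tilings_def)
qed

lemma inj_inflate_pair:
  assumes "k > 0"
  shows "inj (inflate_pair k)"
proof (rule injI, clarsimp simp: inflate_pair_def)
  fix A B A' B' :: "nat set"
  assume A: "inflate k A = inflate k A'" and B: "(*) k ` B = (*) k ` B'"
  have "x \<in> A \<longleftrightarrow> k * x \<in> inflate k A" for x and A using assms by (simp add: inflate_def)
  with A have "A = A'" by blast
  moreover have "inj ((*) k)" using assms by (auto simp: inj_on_def)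
  with B have "B = B'" by (simp add: inj_image_eq_iff)
  ultimately show "B = B' \<and> A = A'" by simp
qed

text \<open>As 1 belongs to the first component of \<open>p\<close>, the scaled set contains
  \<open>k\<close>, which is therefore a positive multiple of \<open>l\<close>; the converse is
  symmetric.\<close>

lemma inflate_pair_disjoint:
  assumes "k > 0" "l > 0" "p \<in> tilings b a" "q \<in> tilings b' a'" "inflate_pair k p = inflate_pair l q"
  shows "k = l"
proof -
  have *: "k \<ge> l" if "k > 0" "1 \<in> (B :: nat set)" "(*) k ` B = (*) l ` B'" for k l B B'
  proof -
    have "k \<in> (*) l ` B'" using that by (metis image_eqI mult.right_neutral)
    with that show ?thesis by auto
  qed
  show ?thesis
    using assms *[of k "fst p" l "fst q"] *[of l "fst q" k "fst p"]
    by (auto simp: inflate_pair_def tilings_def)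
qed

section \<open>Counting the tilings\<close>

lemma tilings_1:
  assumes "a \<ge> 2"
  shows "tilings a 1 = {({..<a}, {0})}"
proof (intro equalityI subsetI)
  fix p assume "p \<in> tilings a 1"
  then obtain A B where p: "p = (A, B)" "card B = 1" and T: "tiles A B a"
    by (auto simp: tilings_def)
  have "0 \<in> B" using tiles_0_mem[OF T] assms by simp
  with p have B: "B = {0}" by (metis card_1_singletonE singletonD)
  have "A = {..<a}"
  proof (intro equalityI subsetI)
    fix x assume "x \<in> A" then show "x \<in> {..<a}" using tiles_less[OF T] B by fastforce
  next
    fix x assume "x \<in> {..<a}" then show "x \<in> A" using tiles_obtain[OF T] B by fastforce
  qed
  with p B show "p \<in> {({..<a}, {0})}" by simp
next
  fix p assume "p \<in> {({..<a}, {0::nat})}"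
  then show "p \<in> tilings a 1" using assms by (auto simp: tilings_def intro!: tilesI)
qed

lemma c_1:
  assumes "a \<ge> 2"
  shows "c (Suc 0) a = 1"
proof -
  have "ofacs (Suc 0) a = {[int a]}"
    using assms by (auto simp: ofacs_def length_Suc_conv)
  then show ?thesis by (simp add: c_eq_card_ofacs)
qed

text \<open>The recursion passes from \<open>(a, b)\<close> to \<open>(b, a div k)\<close>, hence
  the induction on \<open>a + b\<close>. One bound \<open>J\<close> above both values of
  \<open>Omega\<close> survives the exchange of roles. Finiteness is carried along for the
  cardinality of the union.\<close>

lemma finite_tilings_and_card:
  assumes "a \<ge> 2" "b \<ge> 1" "Omega a < J" "Omega b < J"
  shows "finite (tilings a b) \<and> card (tilings a b) = (\<Sum>j<J. c j b * (c j a + c (Suc j) a))"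
  using assms
proof (induction "a + b" arbitrary: a b rule: less_induct)
  case less
  obtain J' where J: "J = Suc J'" using less.prems by (cases J) auto
  show ?case
  proof (cases "b = 1")
    case True
    \<comment> \<open>Only \<open>j = 0\<close> survives, with \<open>c 0 1 = 1\<close>,
      \<open>c 0 a = 0\<close> and \<open>c 1 a = 1\<close>.\<close>
    have "(\<Sum>j<J. c j 1 * (c j a + c (Suc j) a)) = 1"
      using less.prems by (simp add: J sum.lessThan_Suc_shift c_0 c_1 c_Suc_1[unfolded One_nat_def] del: sum.lessThan_Suc)
    then show ?thesis using True tilings_1[OF less.prems(1)] by simp
  next
    case False
    with less.prems have b: "b \<ge> 2" and a: "a \<ge> 1" by auto
    have IH: "finite (tilings b (a div k))"
      "card (tilings b (a div k)) = (\<Sum>j<J. c j (a div k) * (c j b + c (Suc j) b))"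
      if k: "k \<in> pdivs a" for k
    proof -
      have "a div k < a" using k a by (auto simp: pdivs_def)
      then have "b + a div k < a + b" by simp
      from less.hyps[OF this b div_pdivs_ge_1[OF a k] less.prems(4)] Omega_div_less[OF a k] less.prems(3)
      show "finite (tilings b (a div k))"
        "card (tilings b (a div k)) = (\<Sum>j<J. c j (a div k) * (c j b + c (Suc j) b))"
        by auto
    qed
    have fin: "finite (tilings a b)"
      unfolding tilings_step[OF a b] using IH(1) a by auto
    have pos: "k > 0" if "k \<in> pdivs a" for k using that by (simp add: pdivs_def)
    have "card (tilings a b) = (\<Sum>k\<in>pdivs a. card (inflate_pair k ` tilings b (a div k)))"
      unfolding tilings_step[OF a b]
    proof (rule card_UN_disjoint)
      show "\<forall>k\<in>pdivs a. \<forall>l\<in>pdivs a. k \<noteq> l \<longrightarrow>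
          inflate_pair k ` tilings b (a div k) \<inter> inflate_pair l ` tilings b (a div l) = {}"
        using inflate_pair_disjoint pos by blast
    qed (use a IH(1) in auto)
    also have "\<dots> = (\<Sum>k\<in>pdivs a. \<Sum>j<J. c j (a div k) * (c j b + c (Suc j) b))"
    proof (rule sum.cong[OF refl])
      fix k assume k: "k \<in> pdivs a"
      have "inj_on (inflate_pair k) (tilings b (a div k))"
        using inj_inflate_pair[OF pos[OF k]] by (rule inj_on_subset) simp
      then show "card (inflate_pair k ` tilings b (a div k))
          = (\<Sum>j<J. c j (a div k) * (c j b + c (Suc j) b))"
        by (simp add: card_image IH(2)[OF k])
    qed
    \<comment> \<open>Exchanging the sums collects the terms over \<open>k\<close> by the
      first-factor recursion.\<close>
    also have "\<dots> = (\<Sum>j<J. c (Suc j) a * (c j b + c (Suc j) b))"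
      unfolding c_Suc[OF a] sum_distrib_right by (rule sum.swap)
    also have "\<dots> = (\<Sum>j<J. c j b * c (Suc j) a) + (\<Sum>j<J. c (Suc j) b * c (Suc j) a)"
      by (simp add: sum.distrib[symmetric] algebra_simps)
    \<comment> \<open>The index shift is free since \<open>c 0 b = 0\<close> for
      \<open>b \<ge> 2\<close>; the new top term \<open>j = J\<close> vanishes next because
      \<open>Omega a < J\<close>.\<close>
    also have "(\<Sum>j<J. c (Suc j) b * c (Suc j) a) = (\<Sum>j<Suc J. c j b * c j a)"
      using b by (simp add: sum.lessThan_Suc_shift c_0 del: sum.lessThan_Suc)
    also have "\<dots> = (\<Sum>j<J. c j b * c j a)"
      using c_eq_0[OF a less.prems(3)] by simp
    finally show ?thesis using fin by (simp add: sum.distrib algebra_simps)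
  qed
qed

text \<open>Symmetry of both factors amounts to condition (R), which is therefore automatic.\<close>

definition symmetric_set :: "nat set \<Rightarrow> bool" where
  "symmetric_set A \<longleftrightarrow> (\<exists>s. \<forall>x\<in>A. x \<le> s \<and> s - x \<in> A)"

text \<open>Reflecting \<open>x\<close> in \<open>k * s + (k - 1)\<close> reflects its quotient in
  \<open>s\<close> and its remainder in \<open>k - 1\<close>.\<close>

lemma symmetric_set_inflate:
  assumes "k > 0" "symmetric_set A"
  shows "symmetric_set (inflate k A)"
proof -
  obtain s where s: "\<And>x. x \<in> A \<Longrightarrow> x \<le> s \<and> s - x \<in> A"
    using assms by (auto simp: symmetric_set_def)
  have "x \<le> k * s + (k - 1) \<and> k * s + (k - 1) - x \<in> inflate k A" if "x \<in> inflate k A" for x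
  proof -
    from that s have d: "x div k \<le> s" "s - x div k \<in> A" by (auto simp: inflate_def)
    then obtain t where t: "s = x div k + t" by (metis le_add_diff_inverse)
    have m: "x mod k < k" using assms by simp
    have x: "k * s + (k - 1) = x + (k * t + (k - 1 - x mod k))"
      using m mult_div_mod_eq[of k x] unfolding t distrib_left by linarith
    have "(k * t + (k - 1 - x mod k)) div k = t"
      by (rule div_nat_eqI) (use m in auto)
    with x d t show ?thesis by (simp add: inflate_def)
  qed
  then show ?thesis unfolding symmetric_set_def by blast
qed

lemma symmetric_set_scale:
  assumes "symmetric_set A"
  shows "symmetric_set ((*) k ` A)"
proof -
  obtain s where "\<And>x. x \<in> A \<Longrightarrow> x \<le> s \<and> s - x \<in> A"
    using assms by (auto simp: symmetric_set_def)
  then have "\<forall>x\<in>(*) k ` A. x \<le> k * s \<and> k * s - x \<in> (*) k ` A"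
    by (auto simp flip: diff_mult_distrib2)
  then show ?thesis unfolding symmetric_set_def by blast
qed

text \<open>Symmetry holds for an interval and for {0}, and both operations of the recursion
  preserve it.\<close>

lemma tilings_symmetric:
  assumes "a \<ge> 2" "b \<ge> 1" "(A, B) \<in> tilings a b"
  shows "symmetric_set A \<and> symmetric_set B"
  using assms
proof (induction "a + b" arbitrary: a b A B rule: less_induct)
  case less
  show ?case
  proof (cases "b = 1")
    case True
    then have "A = {..<a}" "B = {0}" using less.prems tilings_1 by auto
    moreover have "\<forall>x\<in>{..<a}. x \<le> a - 1 \<and> a - 1 - x \<in> {..<a}" by auto
    ultimately show ?thesis unfolding symmetric_set_def by (intro conjI) (blast, simp)
  next
    case False
    with less.prems have b: "b \<ge> 2" and a: "a \<ge> 1" by auto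
    from less.prems(3)[unfolded tilings_step[OF a b]]
    obtain k A' B' where k: "k \<in> pdivs a" and t: "(B', A') \<in> tilings b (a div k)"
      and AB: "A = inflate k A'" "B = (*) k ` B'"
      by (auto simp: inflate_pair_def)
    have "a div k < a" using k a by (auto simp: pdivs_def)
    then have "b + a div k < a + b" by simp
    from less.hyps[OF this b div_pdivs_ge_1[OF a k] t] k
    show ?thesis
      unfolding AB by (simp add: pdivs_def symmetric_set_inflate symmetric_set_scale)
  qed
qed

subsection \<open>Principal reversible squares as tilings\<close>

definition idx :: "nat \<Rightarrow> int \<Rightarrow> nat" where
  "idx n i = nat ((i - 1) mod int n)"

lemma ent_idx: "ent n M i j = M (idx n i) (idx n j)"
  by (simp add: ent_def idx_def)

lemma idx_less: "n \<ge> 1 \<Longrightarrow> idx n i < n"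
  by (simp add: idx_def nat_less_iff)

lemma idx_shift: "i < n \<Longrightarrow> idx n (int i + 1) = i"
  by (simp add: idx_def)

text \<open>If \<open>i - 1\<close> has remainder \<open>r\<close> modulo \<open>n\<close>, then
  \<open>n - i\<close> is congruent to \<open>n - 1 - r\<close>, which is already reduced.\<close>

lemma idx_reflect:
  assumes "n \<ge> 1"
  shows "idx n (int n + 1 - i) = n - 1 - idx n i"
proof -
  define r where "r = (i - 1) mod int n"
  have r: "0 \<le> r" "r < int n" using assms by (auto simp: r_def)
  have "int n + 1 - i - 1 = (int n - 1 - r) + int n * (- ((i - 1) div int n))"
    using div_mult_mod_eq[of "i - 1" "int n"] by (simp add: r_def algebra_simps)
  then have "(int n + 1 - i - 1) mod int n = (int n - 1 - r) mod int n"
    by (metis mod_mult_self2)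
  also have "\<dots> = int n - 1 - r" using r by simp
  finally show ?thesis using r by (simp add: idx_def r_def nat_diff_distrib')
qed

text \<open>The labels map onto the \<open>n\<close> positions, so conditions on all integer labels
  become finite ones.\<close>

lemma all_idx_iff:
  assumes "n \<ge> 1"
  shows "(\<forall>i. Q (idx n i)) \<longleftrightarrow> (\<forall>i<n. Q i)"
proof (intro iffI allI impI)
  fix i assume "\<forall>i. Q (idx n i)" "i < n"
  then have "Q (idx n (int i + 1))" by blast
  with \<open>i < n\<close> show "Q i" by (simp add: idx_shift)
qed (use idx_less[OF assms] in blast)

lemma ball_labels_iff: "(\<forall>i\<in>{1..int n}. Q i) \<longleftrightarrow> (\<forall>i<n. Q (int i + 1))"
proof
  assume r: "\<forall>i<n. Q (int i + 1)"
  show "\<forall>i\<in>{1..int n}. Q i"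
  proof
    fix i assume "i \<in> {1..int n}"
    then show "Q i" using r[rule_format, of "nat (i - 1)"] by auto
  qed
qed auto

lemma reversible_square_iff:
  assumes "n \<ge> 1"
  shows "reversible_square n M \<longleftrightarrow>
     (\<forall>i<n. \<forall>j<n. \<forall>k<n. M i j + M i (n - 1 - j) = M i k + M i (n - 1 - k)
                      \<and> M i j + M (n - 1 - i) j = M k j + M (n - 1 - k) j)
   \<and> (\<forall>i<n. \<forall>j<n. \<forall>k<n. \<forall>l<n. M i j + M k l = M i l + M k j)"
  unfolding reversible_square_def ent_idx idx_reflect[OF assms] all_idx_iff[OF assms, symmetric] ..

lemma principal_reversible_square_iff:
  assumes "n \<ge> 2"
  shows "principal_reversible_square n M \<longleftrightarrow> reversible_square n M
   \<and> (\<lambda>(i, j). M i j) ` ({..<n} \<times> {..<n}) = real ` {1..n^2}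
   \<and> (\<forall>i<n. \<forall>j<n. \<forall>j'<n. j < j' \<longrightarrow> M i j < M i j')
   \<and> (\<forall>j<n. \<forall>i<n. \<forall>i'<n. i < i' \<longrightarrow> M i j < M i' j)
   \<and> M 0 0 = 1 \<and> M 0 1 = 2"
proof -
  have "{ent n M i j | i j. i \<in> {1..int n} \<and> j \<in> {1..int n}} = (\<lambda>(i, j). M i j) ` ({..<n} \<times> {..<n})"
    (is "?L = ?R")
  proof (intro equalityI subsetI)
    fix x assume "x \<in> ?L"
    then obtain i j where x: "x = M (idx n i) (idx n j)" by (auto simp: ent_idx)
    have "(idx n i, idx n j) \<in> {..<n} \<times> {..<n}" using idx_less[of n] assms by auto
    with x show "x \<in> ?R" by force
  next
    fix x assume "x \<in> ?R"
    then obtain i j where "i < n" "j < n" "x = M i j" by auto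
    then have "x = ent n M (int i + 1) (int j + 1)" by (simp add: ent_idx idx_shift)
    with \<open>i < n\<close> \<open>j < n\<close> show "x \<in> ?L" by fastforce
  qed
  moreover have "idx n 1 = 0" "idx n 2 = 1"
    using idx_shift[of 0 n] idx_shift[of 1 n] assms by simp_all
  moreover have "int j + 1 < int j' + 1 \<longleftrightarrow> j < j'" for j j' by linarith
  ultimately show ?thesis
    unfolding principal_reversible_square_def ball_labels_iff
    by (simp add: ent_idx idx_shift)
qed

section \<open>From tilings to squares and back\<close>

definition tiling_matrix :: "nat \<Rightarrow> nat set \<times> nat set \<Rightarrow> nat \<Rightarrow> nat \<Rightarrow> real" where
  "tiling_matrix n p = (\<lambda>i j. if i < n \<and> j < n
     then real (1 + sorted_list_of_set (fst p) ! j + sorted_list_of_set (snd p) ! i) else 0)"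

text \<open>The map \<open>x \<mapsto> s - x\<close> is an order-reversing bijection of
  \<open>A\<close>, so applying it to the sorted list and reversing gives the sorted list
  again.\<close>

lemma sorted_list_symmetric:
  assumes fin: "finite A" and sym: "symmetric_set A"
  obtains s where "\<And>j. j < card A \<Longrightarrow>
    sorted_list_of_set A ! j + sorted_list_of_set A ! (card A - 1 - j) = s"
proof -
  let ?L = "sorted_list_of_set A"
  from sym obtain s where s: "\<And>x. x \<in> A \<Longrightarrow> x \<le> s \<and> s - x \<in> A" by (auto simp: symmetric_set_def)
  have "(\<lambda>x. s - x) ` A = A"
  proof (intro equalityI subsetI)
    fix x assume "x \<in> A"
    with s[of x] have "x = s - (s - x)" "s - x \<in> A" by auto
    then show "x \<in> (\<lambda>x. s - x) ` A" by blast
  qed (use s in auto)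
  then have set: "set (rev (map (\<lambda>x. s - x) ?L)) = set ?L" using fin by simp
  have inj: "inj_on (\<lambda>x. s - x) A" 
    using s by (metis diff_diff_cancel inj_onI)
  have "sorted (rev (map (\<lambda>x. s - x) ?L))"
    unfolding sorted_rev_iff_nth_mono by (auto intro!: diff_le_mono2 sorted_nth_mono)
  moreover have "distinct (rev (map (\<lambda>x. s - x) ?L))"
    using fin inj by (simp add: distinct_map)
  ultimately have eq: "rev (map (\<lambda>x. s - x) ?L) = ?L"
    using set by (intro sorted_distinct_set_unique) auto
  show ?thesis
  proof (rule that[of s])
    fix j assume j: "j < card A"
    then have "?L ! j = rev (map (\<lambda>x. s - x) ?L) ! j" by (simp add: eq)
    also have "\<dots> = s - ?L ! (card A - 1 - j)" using j by (simp add: rev_nth)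
    finally have "?L ! j = s - ?L ! (card A - 1 - j)" .
    moreover have "?L ! (card A - 1 - j) \<in> A"
      using nth_mem[of "card A - 1 - j" ?L] j fin by simp
    ultimately show "?L ! j + ?L ! (card A - 1 - j) = s" using s[of "?L ! (card A - 1 - j)"] by simp
  qed
qed

lemma tiling_matrix_principal:
  assumes n: "n \<ge> 2" and p: "(A, B) \<in> tilings n n"
  shows "principal_reversible_square n (tiling_matrix n (A, B))"
proof -
  let ?M = "tiling_matrix n (A, B)"
  let ?a = "\<lambda>j. sorted_list_of_set A ! j" and ?b = "\<lambda>i. sorted_list_of_set B ! i"
  from p have T: "tiles A B (n * n)" and card: "card A = n" "card B = n" and one: "1 \<in> A"
    by (auto simp: tilings_def)
  have fin: "finite A" "finite B" using card n by (auto intro: card_ge_0_finite)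
  have len: "length (sorted_list_of_set A) = n" "length (sorted_list_of_set B) = n"
    using card by simp_all
  have M: "?M i j = real (1 + ?a j + ?b i)" if "i < n" "j < n" for i j
    using that by (simp add: tiling_matrix_def)
  have symm: "symmetric_set A" "symmetric_set B" using tilings_symmetric[OF n _ p] n by auto
  obtain s where s: "\<And>j. j < n \<Longrightarrow> ?a j + ?a (n - 1 - j) = s"
    using sorted_list_symmetric[OF fin(1) symm(1)] card by metis
  obtain t where t: "\<And>j. j < n \<Longrightarrow> ?b j + ?b (n - 1 - j) = t"
    using sorted_list_symmetric[OF fin(2) symm(2)] card by metis
  have mono: "?a j < ?a j'" "?b j < ?b j'" if "j < j'" "j' < n" for j j'
    using that len strict_sorted_list_of_set[of A] strict_sorted_list_of_set[of B]
    by (simp_all add: sorted_wrt_iff_nth_less)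
  have surj: "?a ` {..<n} = A" "?b ` {..<n} = B"
    using fin len by (metis atLeast_upt list.set_map map_nth set_sorted_list_of_set)+
  have zero: "0 \<in> A" "0 \<in> B" using tiles_0_mem[OF T] n by auto
  have first: "?a 0 = 0" "?b 0 = 0"
    using surj zero mono n by (metis gr_zeroI imageE lessThan_iff less_nat_zero_code)+
  \<comment> \<open>The value 1 occurs at a positive position, so \<open>?a 1 \<le> 1\<close>, while
    \<open>?a 1 > ?a 0 = 0\<close>.\<close>
  have second: "?a 1 = 1"
  proof -
    obtain j where j: "j < n" "?a j = 1" using one surj by (metis imageE lessThan_iff)
    then have "j \<noteq> 0" using first(1) by (metis zero_neq_one)
    have "?a 1 > 0" using mono(1)[of 0 1] n by simp
    moreover have "j = 1 \<or> ?a 1 < ?a j" using \<open>j \<noteq> 0\<close> mono(1)[of 1 j] j by linarith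
    ultimately show ?thesis using j by auto
  qed
  have img: "(\<lambda>(i, j). ?M i j) ` ({..<n} \<times> {..<n}) = real ` {1..n^2}"
  proof (intro equalityI subsetI)
    fix x assume "x \<in> (\<lambda>(i, j). ?M i j) ` ({..<n} \<times> {..<n})"
    then obtain i j where ij: "i < n" "j < n" "x = real (1 + ?a j + ?b i)" using M by auto
    then have "?a j \<in> A" "?b i \<in> B" using surj by auto
    then have "?a j + ?b i < n * n" by (rule tiles_less[OF T])
    then have "1 + ?a j + ?b i \<in> {1..n^2}" by (simp add: power2_eq_square)
    with ij show "x \<in> real ` {1..n^2}" by blast
  next
    fix x assume "x \<in> real ` {1..n^2}"
    then obtain y where y: "x = real y" "1 \<le> y" "y \<le> n * n" by (auto simp: power2_eq_square)
    define z where "z = y - 1"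
    have z: "z < n * n" "x = real (1 + z)" using y by (auto simp: z_def)
    obtain a b where ab: "a \<in> A" "b \<in> B" "z = a + b" using tiles_obtain[OF T z(1)] .
    have "a \<in> ?a ` {..<n}" "b \<in> ?b ` {..<n}" unfolding surj by (fact ab)+
    then obtain i j where ij: "i < n" "j < n" "a = ?a j" "b = ?b i" by blast
    then have "(i, j) \<in> {..<n} \<times> {..<n}" "x = ?M i j"
      unfolding M[OF ij(1,2)] z(2) ab(3) by simp_all
    then show "x \<in> (\<lambda>(i, j). ?M i j) ` ({..<n} \<times> {..<n})" by force
  qed
  have "reversible_square n ?M"
  proof -
    have "?M i j + ?M i (n - 1 - j) = real (2 + s + 2 * ?b i)" if "i < n" "j < n" for i j
      using that s[OF that(2), symmetric] by (simp add: M)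
    moreover have "?M i j + ?M (n - 1 - i) j = real (2 + t + 2 * ?a j)" if "i < n" "j < n" for i j
      using that t[OF that(1), symmetric] by (simp add: M)
    ultimately show ?thesis using n by (simp add: reversible_square_iff M)
  qed
  then show ?thesis
    using n img mono first second by (simp add: principal_reversible_square_iff[OF n] M)
qed

lemma principal_is_tiling_matrix:
  assumes n: "n \<ge> 2" and P: "principal_reversible_square n M"
    and zero: "\<forall>i j. (i \<ge> n \<or> j \<ge> n) \<longrightarrow> M i j = 0"
  shows "M \<in> tiling_matrix n ` tilings n n"
proof -
  note P' = P[unfolded principal_reversible_square_iff[OF n]]
  have img: "(\<lambda>(i, j). M i j) ` ({..<n} \<times> {..<n}) = real ` {1..n^2}"
    and row: "\<And>i j j'. i < n \<Longrightarrow> j' < n \<Longrightarrow> j < j' \<Longrightarrow> M i j < M i j'"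
    and col: "\<And>j i i'. j < n \<Longrightarrow> i' < n \<Longrightarrow> i < i' \<Longrightarrow> M i j < M i' j"
    and M0: "M 0 0 = 1" "M 0 1 = 2"
    using P' by auto
  have V: "M i j + M k l = M i l + M k j" if "i < n" "j < n" "k < n" "l < n" for i j k l
  proof -
    have "reversible_square n M" using P' by blast
    moreover have "n \<ge> 1" using n by simp
    ultimately show ?thesis using that reversible_square_iff[of n M] by blast
  qed
  have ex: "\<exists>m. M i j = 1 + real m" if "i < n" "j < n" for i j
  proof -
    have "M i j \<in> real ` {1..n^2}" using that img by force
    then obtain z where "M i j = real z" "z \<ge> 1" by auto
    then have "M i j = 1 + real (z - 1)" by simp
    then show ?thesis ..
  qed
  have "\<exists>m. j < n \<longrightarrow> M 0 j = 1 + real m" for j using ex[of 0 j] n by auto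
  then obtain a where a: "\<And>j. j < n \<Longrightarrow> M 0 j = 1 + real (a j)" by metis
  have "\<exists>m. i < n \<longrightarrow> M i 0 = 1 + real m" for i using ex[of i 0] n by auto
  then obtain b where b: "\<And>i. i < n \<Longrightarrow> M i 0 = 1 + real (b i)" by metis
  \<comment> \<open>Condition (V) against the corner entry 1 makes row 0 and column 0 determine the
    matrix.\<close>
  have M: "M i j = real (1 + a j + b i)" if "i < n" "j < n" for i j
    using V[of i j 0 0] that a[OF that(2)] b[OF that(1)] M0 by simp
  define A B where "A = a ` {..<n}" and "B = b ` {..<n}"
  have mono_a: "a j < a j'" if "j < j'" "j' < n" for j j'
    using row[of 0 j' j] a[of j] a[of j'] that by simp
  have mono_b: "b j < b j'" if "j < j'" "j' < n" for j j'
    using col[of 0 j' j] b[of j] b[of j'] that by simp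
  have inj: "inj_on a {..<n}" "inj_on b {..<n}"
    using mono_a mono_b by (metis inj_onI lessThan_iff less_irrefl linorder_neqE_nat)+
  have card: "card A = n" "card B = n" using inj by (simp_all add: A_def B_def card_image)
  have sorted: "sorted_list_of_set (f ` {..<n}) = map f [0..<n]"
    if "\<And>j j'. j < j' \<Longrightarrow> j' < n \<Longrightarrow> f j < f j'" for f :: "nat \<Rightarrow> nat"
  proof -
    have "sorted_wrt (<) (map f [0..<n])" using that by (simp add: sorted_wrt_iff_nth_less)
    moreover have "set (map f [0..<n]) = f ` {..<n}" by (simp add: atLeast0LessThan)
    ultimately show ?thesis
      by (metis finite_imageI finite_lessThan set_sorted_list_of_set strict_sorted_equal
          strict_sorted_list_of_set)
  qed
  have lists: "sorted_list_of_set A = map a [0..<n]" "sorted_list_of_set B = map b [0..<n]"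
    unfolding A_def B_def by (rule sorted, erule (1) mono_a, rule sorted, erule (1) mono_b)
  have "(\<lambda>(x, y). x + y) ` (A \<times> B) = {..<n * n}"
  proof (intro equalityI subsetI)
    fix z assume "z \<in> (\<lambda>(x, y). x + y) ` (A \<times> B)"
    then obtain i j where ij: "i < n" "j < n" "z = a j + b i" by (auto simp: A_def B_def)
    then have "real (1 + z) = M i j" by (simp add: M)
    also have "\<dots> \<in> real ` {1..n^2}" using img ij by force
    finally show "z \<in> {..<n * n}" by (auto simp: power2_eq_square)
  next
    fix z assume "z \<in> {..<n * n}"
    then have "1 + z \<in> {1..n^2}" by (simp add: power2_eq_square)
    then have "real (1 + z) \<in> real ` {1..n^2}" by blast
    then obtain i j where ij: "i < n" "j < n" "real (1 + z) = M i j" unfolding img[symmetric] by auto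
    then have "z = a j + b i" by (simp add: M)
    with ij show "z \<in> (\<lambda>(x, y). x + y) ` (A \<times> B)" by (auto simp: A_def B_def)
  qed
  \<comment> \<open>A map from \<open>n * n\<close> pairs onto \<open>n * n\<close> numbers is
    injective, so uniqueness of representations follows by counting.\<close>
  moreover have "card (A \<times> B) = card {..<n * n}" using card by (simp add: card_cartesian_product)
  moreover have "finite (A \<times> B)" by (simp add: A_def B_def)
  ultimately have "tiles A B (n * n)"
    unfolding tiles_def bij_betw_def by (metis eq_card_imp_inj_on)
  moreover have "a 1 = 1" using a[of 1] M0 n by simp
  then have "1 \<in> A" using n image_eqI[of 1 a 1 "{..<n}"] by (simp add: A_def)
  ultimately have "(A, B) \<in> tilings n n" using card by (simp add: tilings_def)
  moreover have "M = tiling_matrix n (A, B)"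
  proof (intro ext)
    fix i j
    show "M i j = tiling_matrix n (A, B) i j"
    proof (cases "i < n \<and> j < n")
      case True
      then show ?thesis by (simp add: tiling_matrix_def lists M)
    next
      case False
      then have "M i j = 0" using zero by (simp add: not_less) blast
      with False show ?thesis by (simp add: tiling_matrix_def)
    qed
  qed
  ultimately show ?thesis by blast
qed

text \<open>Both sorted lists start with 0, so row 0 displays \<open>A\<close> and column 0 displays
  \<open>B\<close>, each shifted by 1.\<close>

lemma inj_tiling_matrix:
  assumes n: "n \<ge> 2"
  shows "inj_on (tiling_matrix n) (tilings n n)"
proof -
  have rec: "A = {x. \<exists>j<n. tiling_matrix n (A, B) 0 j = 1 + real x}
           \<and> B = {x. \<exists>i<n. tiling_matrix n (A, B) i 0 = 1 + real x}"
    if "(A, B) \<in> tilings n n" for A B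
  proof -
    from that have T: "tiles A B (n * n)" and card: "card A = n" "card B = n"
      by (auto simp: tilings_def)
    have fin: "finite A" "finite B" using card n by (auto intro: card_ge_0_finite)
    have zero: "0 \<in> A" "0 \<in> B" using tiles_0_mem[OF T] n by auto
    have hd: "sorted_list_of_set C ! 0 = 0" if "finite C" "0 \<in> C" for C :: "nat set"
    proof -
      have "C \<noteq> {}" using that by auto
      then have "sorted_list_of_set C = Min C # sorted_list_of_set (C - {Min C})"
        using that by (simp add: sorted_list_of_set_nonempty)
      moreover have "Min C = 0" using that by (metis Min_le le_zero_eq)
      ultimately show ?thesis by simp
    qed
    have "{x. \<exists>j<n. sorted_list_of_set C ! j = x} = C" if "finite C" "card C = n" for C :: "nat set"
    proof -
      have "{x. \<exists>j<n. sorted_list_of_set C ! j = x} = set (sorted_list_of_set C)"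
        using that by (auto simp: set_conv_nth)
      with that show ?thesis by simp
    qed
    from this[OF fin(1) card(1)] this[OF fin(2) card(2)] show ?thesis
      using n by (auto simp: tiling_matrix_def hd[OF fin(1) zero(1)] hd[OF fin(2) zero(2)])
  qed
  show ?thesis
  proof (rule inj_onI)
    fix p q assume pq: "p \<in> tilings n n" "q \<in> tilings n n" "tiling_matrix n p = tiling_matrix n q"
    show "p = q"
      using rec[of "fst p" "snd p"] rec[of "fst q" "snd q"] pq by (simp add: prod_eq_iff)
  qed
qed

section \<open>The counting formula\<close>

lemma N_eq_card_tilings:
  assumes n: "n \<ge> 2"
  shows "N n = card (tilings n n)"
proof -
  have "{M. principal_reversible_square n M \<and> (\<forall>i j. (i \<ge> n \<or> j \<ge> n) \<longrightarrow> M i j = 0)}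
      = tiling_matrix n ` tilings n n"
  proof (intro equalityI subsetI)
    fix M assume "M \<in> tiling_matrix n ` tilings n n"
    then obtain A B where "(A, B) \<in> tilings n n" "M = tiling_matrix n (A, B)" by auto
    then show "M \<in> {M. principal_reversible_square n M \<and> (\<forall>i j. (i \<ge> n \<or> j \<ge> n) \<longrightarrow> M i j = 0)}"
      using tiling_matrix_principal[OF n] by (auto simp: tiling_matrix_def)
  qed (use principal_is_tiling_matrix[OF n] in auto)
  then show ?thesis by (simp add: N_def card_image[OF inj_tiling_matrix[OF n]])
qed

text \<open>For \<open>n = 1\<close> the labels 1 and 2 coincide modulo \<open>n\<close>, so one
  entry would have to be both 1 and 2. This matches the empty sum, as
  \<open>Omega 1 = 0\<close>.\<close>

lemma N_1: "N 1 = 0"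
proof -
  have "\<not> principal_reversible_square 1 M" for M
    by (simp add: principal_reversible_square_def ent_def)
  then show ?thesis by (simp add: N_def)
qed

theorem theorem4:
  fixes n :: nat
  assumes "n \<ge> 1"
  shows "N n = (\<Sum>j=1..Omega n. c j n * (c j n + c (j+1) n))
       \<and> N n = (\<Sum>j=1..Omega n. c j n * c1 j n)"
proof -
  have "N n = (\<Sum>j=1..Omega n. c j n * (c j n + c (j+1) n))"
  proof (cases "n = 1")
    case True
    have "Omega 1 = 0" by (simp add: Omega_def)
    with True show ?thesis by (simp only: N_1) simp
  next
    case False
    with assms have n: "n \<ge> 2" by simp
    have "N n = (\<Sum>j<Suc (Omega n). c j n * (c j n + c (Suc j) n))"
      using finite_tilings_and_card[OF n assms lessI lessI] by (simp add: N_eq_card_tilings[OF n])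
    \<comment> \<open>The term \<open>j = 0\<close> drops out because \<open>c 0 n = 0\<close> for
      \<open>n \<ge> 2\<close>.\<close>
    also have "\<dots> = (\<Sum>j<Omega n. c (Suc j) n * (c (Suc j) n + c (Suc (Suc j)) n))"
      using n by (simp add: sum.lessThan_Suc_shift c_0 del: sum.lessThan_Suc)
    also have "\<dots> = (\<Sum>j=1..Omega n. c j n * (c j n + c (j+1) n))"
      by (simp add: sum.atLeast1_atMost_eq)
    finally show ?thesis .
  qed
  then show ?thesis by (simp add: c1_eq[OF assms])
qed

end
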